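(* Let $d\ge2$, let $\Pi$ be the $d$-dimensional product copula with order transform $\Pi_T$, and let $K\subseteq\{1,\dots,d\}$ with $|K|\ge 2$. Then the margin $\varrho_K(\Pi_T)$ satisfies $$\big[\varrho_K(\Pi_T),\varrho_K(\Pi_T)\big]=\int_{[0,1]^d}\Pi_T(\boldsymbol\eta_K(\mathbf 1,\mathbf u))\,dQ^{\Pi_T}(\mathbf u)=\int_{\overline{\mathbb R}^d}H^\Pi_T(\boldsymbol\eta_K(\mathbf 1,\mathbf x))\,dQ^{H^\Pi_T}(\mathbf x)=d!\int_{T([0,1]^d)}H^\Pi_T(\boldsymbol\eta_K(\mathbf 1,\mathbf u))\,dQ^{\Pi}(\mathbf u).$$
   Context: Notation: $\overline{\mathbb R}=[-\infty,\infty]$; $\mathbf 1=(1,\dots,1)$. The product copula is $\Pi(\mathbf u)=\prod_{k=1}^d u_k$ on $[0,1]^d$. For a copula $C$, $Q^C$ is the unique Borel probability measure on the unit cube with $Q^C[[\mathbf 0,\mathbf u]]=C(\mathbf u)$ for all $\mathbf u$ (so $Q^\Pi$ is Lebesgue measure on $[0,1]^d$); for a distribution function $F$ on $\overline{\mathbb R}^d$, $Q^F$ is the corresponding probability measure. For copulas $C,D$ on the same unit cube $[0,1]^n$, $[C,D]:=\int_{[0,1]^n}C\,dQ^D$. For $\mathbf x,\mathbf y\in\overline{\mathbb R}^d$ (in particular in $[0,1]^d$), $\boldsymbol\eta_K(\mathbf x,\mathbf y)$ is the vector whose $k$-th coordinate is $y_k$ if $k\in K$ and $x_k$ if $k\notin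 K$. Margin: for $K=\{k_1<\dots<k_{|K|}\}$ and a copula $C$ on $[0,1]^d$, $\varrho_K(C):[0,1]^{K}\to[0,1]$ is the $|K|$-dimensional copula $\varrho_K(C)(\mathbf v):=C(\tilde\varrho_K(\mathbf v))$, where $\tilde\varrho_K(\mathbf v)\in[0,1]^d$ has $k_j$-th coordinate equal to the $j$-th coordinate of $\mathbf v$ and all coordinates outside $K$ equal to $1$. Order transform: $T:\overline{\mathbb R}^d\to\overline{\mathbb R}^d$ is $(T(\mathbf x))_k:=\min_{J\subseteq\{1,\dots,d\},|J|=k}\max_{l\in J}x_l$, i.e. $T(\mathbf x)$ is the nondecreasing rearrangement of $\mathbf x$. For a copula $C$, let $H^C:\overline{\mathbb R}^d\to[0,1]$ be the distribution function extending $C$, i.e. $H^C(\mathbf x)=C(h(x_1),\dots,h(x_d))$ with $h(x)=\max\{0,\min\{x,1\}\}$. Let $H^C_T$ be the distribution function of the image measure $(Q^{H^C})_T=Q^{H^C}\circ T^{-1}$. Its univariate marginal distribution functions $(H^C_T)_1,\dots,(H^C_T)_d$ are continuous, so there is a unique copula $C_T$, called the order transform of $C$, with $H^C_T(\mathbf x)=C_T\big((H^C_T)_1(x_1),\dots,(H^C_T)_d(x_d)\big)$ for all $\mathbf x\in\overline{\mathbb R}^d$. *)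

theory Defs
  imports "HOL-Probability.Probability"
begin

text \<open>
  A vector of length \<open>n\<close> over \<open>A\<close> is an element of \<open>{1..n} \<rightarrow>\<^sub>E A\<close>; points of the unit cube have
  entries of type \<^typ>\<open>real\<close>, points of the extended space have entries of type \<^typ>\<open>ereal\<close>.
\<close>

definition cube :: "nat \<Rightarrow> (nat \<Rightarrow> real) set" where
  "cube n = {1..n} \<rightarrow>\<^sub>E {0..1}"

definition const_vec :: "nat \<Rightarrow> 'a \<Rightarrow> nat \<Rightarrow> 'a" where
  "const_vec n c = (\<lambda>k\<in>{1..n}. c)"

definition ereal_vec :: "nat \<Rightarrow> (nat \<Rightarrow> real) \<Rightarrow> nat \<Rightarrow> ereal" where
  "ereal_vec n u = (\<lambda>k\<in>{1..n}. ereal (u k))"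

abbreviation eta :: "nat set \<Rightarrow> (nat \<Rightarrow> 'a) \<Rightarrow> (nat \<Rightarrow> 'a) \<Rightarrow> nat \<Rightarrow> 'a" where
  "eta K x y \<equiv> override_on x y K"

definition copula :: "nat \<Rightarrow> ((nat \<Rightarrow> real) \<Rightarrow> real) \<Rightarrow> bool" where
  "copula n C \<longleftrightarrow>
     C \<in> cube n \<rightarrow>\<^sub>E {0..1} \<and>
     (\<forall>u\<in>cube n. \<forall>v\<in>cube n. (\<forall>k\<in>{1..n}. u k \<le> v k) \<longrightarrow>
        0 \<le> (\<Sum>K\<in>Pow {1..n}. (-1) ^ (n - card K) * C (eta K u v))) \<and>
     (\<forall>u\<in>cube n. \<forall>k\<in>{1..n}. C (eta {k} u (const_vec n 0)) = 0) \<and>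
     (\<forall>u\<in>cube n. \<forall>k\<in>{1..n}. C (eta {k} (const_vec n 1) u) = u k)"

definition product_copula :: "nat \<Rightarrow> (nat \<Rightarrow> real) \<Rightarrow> real" where
  "product_copula d = (\<lambda>u\<in>cube d. \<Prod>k\<in>{1..d}. u k)"

definition copula_measure :: "nat \<Rightarrow> ((nat \<Rightarrow> real) \<Rightarrow> real) \<Rightarrow> (nat \<Rightarrow> real) measure" where
  "copula_measure n C = (THE Q.
     prob_space Q \<and>
     sets Q = sets (Pi\<^sub>M {1..n} (\<lambda>_. restrict_space borel {0..1})) \<and>
     (\<forall>u\<in>cube n. measure Q {v \<in> cube n. \<forall>k\<in>{1..n}. v k \<le> u k} = C u))"

definition copula_pairing ::
  "nat \<Rightarrow> ((nat \<Rightarrow> real) \<Rightarrow> real) \<Rightarrow> ((nat \<Rightarrow> real) \<Rightarrow> real) \<Rightarrow> real" where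
  "copula_pairing n C D = (\<integral>u. C u \<partial>copula_measure n D)"

text \<open>
  For \<open>k \<in> K\<close>, the number \<open>card {l \<in> K. l \<le> k}\<close> is the index \<open>j\<close> with \<open>k = k\<^sub>j\<close> in the
  enumeration \<open>k\<^sub>1 < k\<^sub>2 < \<dots>\<close> of \<open>K\<close>.
\<close>

definition margin_embed :: "nat \<Rightarrow> nat set \<Rightarrow> (nat \<Rightarrow> real) \<Rightarrow> nat \<Rightarrow> real" where
  "margin_embed d K v = (\<lambda>k\<in>{1..d}. if k \<in> K then v (card {l \<in> K. l \<le> k}) else 1)"

definition margin :: "nat \<Rightarrow> nat set \<Rightarrow> ((nat \<Rightarrow> real) \<Rightarrow> real) \<Rightarrow> (nat \<Rightarrow> real) \<Rightarrow> real" where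
  "margin d K C = (\<lambda>v\<in>cube (card K). C (margin_embed d K v))"

definition order_map :: "nat \<Rightarrow> (nat \<Rightarrow> 'a::linorder) \<Rightarrow> nat \<Rightarrow> 'a" where
  "order_map d x = (\<lambda>k\<in>{1..d}. Min ((\<lambda>J. Max (x ` J)) ` {J. J \<subseteq> {1..d} \<and> card J = k}))"

abbreviation ext_space :: "nat \<Rightarrow> (nat \<Rightarrow> ereal) measure" where
  "ext_space d \<equiv> Pi\<^sub>M {1..d} (\<lambda>_. borel)"

definition dist_fun :: "nat \<Rightarrow> (nat \<Rightarrow> ereal) measure \<Rightarrow> (nat \<Rightarrow> ereal) \<Rightarrow> real" where
  "dist_fun d Q = (\<lambda>x\<in>{1..d} \<rightarrow>\<^sub>E UNIV. measure Q {y \<in> {1..d} \<rightarrow>\<^sub>E UNIV. \<forall>k\<in>{1..d}. y k \<le> x k})"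

definition dist_measure :: "nat \<Rightarrow> ((nat \<Rightarrow> ereal) \<Rightarrow> real) \<Rightarrow> (nat \<Rightarrow> ereal) measure" where
  "dist_measure d F = (THE Q.
     prob_space Q \<and> sets Q = sets (ext_space d) \<and>
     (\<forall>x\<in>{1..d} \<rightarrow>\<^sub>E UNIV. dist_fun d Q x = F x))"

definition clip :: "ereal \<Rightarrow> real" where
  "clip x = real_of_ereal (max 0 (min x 1))"

definition copula_ext :: "nat \<Rightarrow> ((nat \<Rightarrow> real) \<Rightarrow> real) \<Rightarrow> (nat \<Rightarrow> ereal) \<Rightarrow> real" where
  "copula_ext d C = (\<lambda>x\<in>{1..d} \<rightarrow>\<^sub>E UNIV. C (\<lambda>k\<in>{1..d}. clip (x k)))"

definition copula_ext_T :: "nat \<Rightarrow> ((nat \<Rightarrow> real) \<Rightarrow> real) \<Rightarrow> (nat \<Rightarrow> ereal) \<Rightarrow> real" where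
  "copula_ext_T d C =
     dist_fun d (distr (dist_measure d (copula_ext d C)) (ext_space d) (order_map d))"

definition univ_margin :: "nat \<Rightarrow> ((nat \<Rightarrow> ereal) \<Rightarrow> real) \<Rightarrow> nat \<Rightarrow> ereal \<Rightarrow> real" where
  "univ_margin d F k t = F (eta {k} (const_vec d \<infinity>) (const_vec d t))"

definition order_transform :: "nat \<Rightarrow> ((nat \<Rightarrow> real) \<Rightarrow> real) \<Rightarrow> (nat \<Rightarrow> real) \<Rightarrow> real" where
  "order_transform d C = (THE D.
     copula d D \<and>
     (\<forall>x\<in>{1..d} \<rightarrow>\<^sub>E UNIV.
        copula_ext_T d C x = D (\<lambda>k\<in>{1..d}. univ_margin d (copula_ext_T d C) k (x k))))"

end

theory Submission
  imports Defs
begin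

text \<open>
  Let \<open>v\<close> be uniform on the unit cube and let \<open>G\<^sub>k\<close> be the distribution function of the \<open>k\<close>-th order
  statistic \<open>(T v)\<^sub>k\<close>, which is continuous because \<open>(T v)\<^sub>k\<close> is one of the coordinates of \<open>v\<close>. Then
  \<open>\<Pi>\<^sub>T\<close> is the distribution function of the random vector \<open>(G\<^sub>k ((T v)\<^sub>k))\<^sub>k\<close>, so the first three
  expressions are all expectations of one function of \<open>v\<close>, after projecting to the coordinates in
  \<open>K\<close> for the first. For the last equality, almost every \<open>v\<close> has distinct coordinates, so exactly
  one of the \<open>d!\<close> coordinate permutations of \<open>v\<close> is increasing, and it equals \<open>T v\<close>; these
  permutations preserve the uniform distribution.
\<close>

section \<open>Measures determined by lower boxes\<close>

lemma sets_borel_eq_sigma_atMost: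
  "sets (borel :: 'a::{linorder_topology,second_countable_topology} measure)
     = sigma_sets UNIV (range atMost)"
proof -
  have "sets (borel :: 'a measure) = sigma_sets UNIV (range greaterThan)"
    by (subst borel_Ioi) simp
  also have "\<dots> = sigma_sets UNIV (range atMost)"
  proof (rule sigma_sets_eqI)
    fix A :: "'a set" assume "A \<in> range greaterThan"
    then obtain a where "A = {a<..}" by auto
    then have "A = UNIV - {..a}" by auto
    then show "A \<in> sigma_sets UNIV (range atMost)"
      by (auto intro: sigma_sets.Compl sigma_sets.Basic)
  next
    fix A :: "'a set" assume "A \<in> range atMost"
    then obtain a where "A = {..a}" by auto
    then have "A = UNIV - {a<..}" by auto
    then show "A \<in> sigma_sets UNIV (range greaterThan)"
      by (auto intro: sigma_sets.Compl sigma_sets.Basic)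
  qed
  finally show ?thesis .
qed

lemma sets_restrict_borel_eq_sigma_atMost:
  fixes S :: "'a::{linorder_topology,second_countable_topology} set"
  assumes "S \<in> sets borel"
  shows "sets (restrict_space borel S) = sigma_sets S ((\<inter>) S ` range atMost)"
  unfolding sets_restrict_space sets_borel_eq_sigma_atMost
  by (rule sigma_sets_Int) (use assms in \<open>auto simp: sets_borel_eq_sigma_atMost\<close>)

text \<open>Lower boxes are closed under intersection and generate the product sigma-algebra, so the
  pi-lambda theorem applies. The bound \<open>m\<close> makes the whole space itself a lower box,
  which serves as the cover of finite measure. Keeping \<open>S\<close> general covers both the unit
  interval and all of \<open>ereal\<close>.\<close>

lemma prob_space_eqI_lower_boxes:
  fixes Q R :: "('i \<Rightarrow> 'a::{linorder_topology,second_countable_topology}) measure"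
  assumes "prob_space Q" "prob_space R" "finite I" and S: "S \<in> sets borel" "S \<subseteq> {..m}"
    and sets: "sets Q = sets (Pi\<^sub>M I (\<lambda>_. restrict_space borel S))"
      "sets R = sets (Pi\<^sub>M I (\<lambda>_. restrict_space borel S))"
    and eq: "\<And>a. measure Q {v \<in> I \<rightarrow>\<^sub>E S. \<forall>i\<in>I. v i \<le> a i}
                = measure R {v \<in> I \<rightarrow>\<^sub>E S. \<forall>i\<in>I. v i \<le> a i}"
  shows "Q = R"
proof -
  interpret Q: prob_space Q by fact
  interpret R: prob_space R by fact
  define E where "E = (\<inter>) S ` range atMost"
  \<comment> \<open>Generating a product sigma-algebra from products of generators requires each
    factor space to be covered by its generator; here \<open>S\<close> is itself a member.\<close>
  have S_E: "S \<in> E"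
    unfolding E_def using S(2) by (intro image_eqI[of _ _ "{..m}"]) auto
  have E_Pow: "E \<subseteq> Pow S" by (auto simp: E_def)
  have sets_S: "sets (restrict_space borel S) = sets (sigma S E)"
    using S(1) by (subst sets_restrict_borel_eq_sigma_atMost, simp, subst sets_measure_of) (auto simp: E_def)
  define B where "B = (\<lambda>a. {v \<in> I \<rightarrow>\<^sub>E S. \<forall>i\<in>I. v i \<le> a i}) ` (UNIV :: ('i \<Rightarrow> 'a) set)"
  have "sets (Pi\<^sub>M I (\<lambda>_. restrict_space borel S)) = sets (Pi\<^sub>M I (\<lambda>_. sigma S E))"
    by (rule sets_PiM_cong) (auto simp: sets_S)
  also have "\<dots> = sets (sigma (Pi\<^sub>E I (\<lambda>_. S))
      {{f \<in> Pi\<^sub>E I (\<lambda>_. S). \<forall>i\<in>j. f i \<in> A i} |A j. j \<in> {I} \<and> A \<in> Pi j (\<lambda>_. E)})"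
    by (rule sets_PiM_sigma[where J="{I}"]) (use \<open>finite I\<close> S_E E_Pow in \<open>auto intro!: exI[of _ "{S}"]\<close>)
  also have "{{f \<in> Pi\<^sub>E I (\<lambda>_. S). \<forall>i\<in>j. f i \<in> A i} |A j. j \<in> {I} \<and> A \<in> Pi j (\<lambda>_. E)}
      = {{f \<in> Pi\<^sub>E I (\<lambda>_. S). \<forall>i\<in>I. f i \<in> A i} |A. A \<in> Pi I (\<lambda>_. E)}"
    by auto
  also have "\<dots> = B"
  proof (intro equalityI subsetI)
    fix X assume "X \<in> {{f \<in> Pi\<^sub>E I (\<lambda>_. S). \<forall>i\<in>I. f i \<in> A i} |A. A \<in> Pi I (\<lambda>_. E)}"
    then obtain A where A: "A \<in> Pi I (\<lambda>_. E)" "X = {f \<in> Pi\<^sub>E I (\<lambda>_. S). \<forall>i\<in>I. f i \<in> A i}"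
      by auto
    have "\<forall>i\<in>I. \<exists>a. A i = S \<inter> {..a}"
      using A(1) by (force simp: E_def Pi_iff)
    then obtain a where "\<forall>i\<in>I. A i = S \<inter> {..a i}" by metis
    then have "X = {v \<in> I \<rightarrow>\<^sub>E S. \<forall>i\<in>I. v i \<le> a i}"
      using A(2) by (auto simp: PiE_iff)
    then show "X \<in> B" by (auto simp: B_def)
  next
    fix X assume "X \<in> B"
    then obtain a where "X = {v \<in> I \<rightarrow>\<^sub>E S. \<forall>i\<in>I. v i \<le> a i}" by (auto simp: B_def)
    then have "X = {f \<in> Pi\<^sub>E I (\<lambda>_. S). \<forall>i\<in>I. f i \<in> S \<inter> {..a i}}"
      by (auto simp: PiE_iff)
    then show "X \<in> {{f \<in> Pi\<^sub>E I (\<lambda>_. S). \<forall>i\<in>I. f i \<in> A i} |A. A \<in> Pi I (\<lambda>_. E)}"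
      by (intro CollectI exI[of _ "\<lambda>i. S \<inter> {..a i}"]) (auto simp: E_def)
  qed
  finally have sets_B: "sets (Pi\<^sub>M I (\<lambda>_. restrict_space borel S)) = sigma_sets (I \<rightarrow>\<^sub>E S) B"
    by (subst (asm) sets_measure_of) (auto simp: B_def)
  have "{v \<in> I \<rightarrow>\<^sub>E S. \<forall>i\<in>I. v i \<le> m} = (I \<rightarrow>\<^sub>E S)"
    using S(2) PiE_mem[of _ I "\<lambda>_. S"] by blast
  then have top: "(I \<rightarrow>\<^sub>E S) \<in> B"
    unfolding B_def by (intro image_eqI[of _ _ "\<lambda>_. m"]) auto
  have "Int_stable B"
  proof (rule Int_stableI)
    fix X Y assume "X \<in> B" "Y \<in> B"
    then obtain a b where "X = {v \<in> I \<rightarrow>\<^sub>E S. \<forall>i\<in>I. v i \<le> a i}"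
      "Y = {v \<in> I \<rightarrow>\<^sub>E S. \<forall>i\<in>I. v i \<le> b i}" by (auto simp: B_def)
    then have "X \<inter> Y = {v \<in> I \<rightarrow>\<^sub>E S. \<forall>i\<in>I. v i \<le> min (a i) (b i)}"
      by auto
    then show "X \<inter> Y \<in> B"
      unfolding B_def by (intro image_eqI[of _ _ "\<lambda>i. min (a i) (b i)"]) auto
  qed
  then show ?thesis
  proof (rule measure_eqI_generator_eq_countable[where E=B and A="{I \<rightarrow>\<^sub>E S}" and \<Omega>="I \<rightarrow>\<^sub>E S"])
    show "emeasure Q X = emeasure R X" if "X \<in> B" for X
      using that eq by (auto simp: B_def Q.emeasure_eq_measure R.emeasure_eq_measure)
  qed (use top in \<open>auto simp: B_def sets sets_B[unfolded B_def]\<close>)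
qed

lemma copula_measure_eqI:
  assumes "prob_space Q" and sets: "sets Q = sets (Pi\<^sub>M {1..n} (\<lambda>_. restrict_space borel {0..1}))"
    and C: "\<And>u. u \<in> cube n \<Longrightarrow> measure Q {v \<in> cube n. \<forall>k\<in>{1..n}. v k \<le> u k} = C u"
  shows "copula_measure n C = Q"
  unfolding copula_measure_def
proof (rule the_equality)
  fix R assume R: "prob_space R \<and>
    sets R = sets (Pi\<^sub>M {1..n} (\<lambda>_. restrict_space borel {0..1})) \<and>
    (\<forall>u\<in>cube n. measure R {v \<in> cube n. \<forall>k\<in>{1..n}. v k \<le> u k} = C u)"
  show "R = Q"
  proof (rule prob_space_eqI_lower_boxes[where I="{1..n}" and S="{0..1}" and m=1])
    fix a :: "nat \<Rightarrow> real"
    let ?b = "\<lambda>u. {v \<in> {1..n} \<rightarrow>\<^sub>E {0..1}. \<forall>k\<in>{1..n}. v k \<le> u k}"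
    show "measure R (?b a) = measure Q (?b a)"
    \<comment> \<open>The values of \<open>C\<close> describe only boxes with corner in the cube. A
      corner with a negative coordinate gives an empty box, and any other corner may be capped at 1
      without changing the box.\<close>
    proof (cases "\<exists>k\<in>{1..n}. a k < 0")
      case True
      then have "?b a = {}" by (force simp: PiE_iff)
      then show ?thesis by (simp only: measure_empty)
    next
      case False
      define u where "u = (\<lambda>k\<in>{1..n}. min (a k) 1)"
      have "?b a = ?b u" by (auto simp: u_def PiE_iff)
      moreover have "u \<in> cube n" using False by (auto simp: u_def cube_def not_less)
      ultimately show ?thesis using R C unfolding cube_def by (simp del: ball_simps)
    qed
  qed (use R assms in auto)
qed (use assms in auto)

lemma dist_measure_eqI:
  assumes "prob_space Q" and sets: "sets Q = sets (ext_space d)"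
    and F: "\<And>x. x \<in> {1..d} \<rightarrow>\<^sub>E UNIV \<Longrightarrow> dist_fun d Q x = F x"
  shows "dist_measure d F = Q"
  unfolding dist_measure_def
proof (rule the_equality)
  have *: "sets (ext_space d) = sets (Pi\<^sub>M {1..d} (\<lambda>_. restrict_space borel (UNIV :: ereal set)))"
    by (intro sets_PiM_cong) (auto simp: sets_restrict_space)
  fix R assume R: "prob_space R \<and> sets R = sets (ext_space d) \<and>
     (\<forall>x\<in>{1..d} \<rightarrow>\<^sub>E UNIV. dist_fun d R x = F x)"
  show "R = Q"
  proof (rule prob_space_eqI_lower_boxes[where I="{1..d}" and S=UNIV and m=\<infinity>])
    fix a :: "nat \<Rightarrow> ereal"
    let ?b = "\<lambda>u. {v \<in> {1..d} \<rightarrow>\<^sub>E UNIV. \<forall>k\<in>{1..d}. v k \<le> u k}"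
    have "restrict a {1..d} \<in> {1..d} \<rightarrow>\<^sub>E UNIV" by auto
    then have "dist_fun d R (restrict a {1..d}) = dist_fun d Q (restrict a {1..d})"
      using R F by auto
    moreover have "?b (restrict a {1..d}) = ?b a" by auto
    ultimately show "measure R (?b a) = measure Q (?b a)"
      by (simp add: dist_fun_def)
  qed (use R assms * in auto)
qed (use assms in auto)

text \<open>The event is the section at \<open>u\<close> of a measurable subset of the product of
  \<open>N\<close> and \<open>M\<close>, and the measure of a section depends measurably on the
  point. This supplies the measurability of every distribution function integrated below, with no
  appeal to continuity.\<close>

lemma borel_measurable_lower_box:
  fixes X :: "'b \<Rightarrow> 'i \<Rightarrow> 'a::{linorder_topology,second_countable_topology}"
  assumes "prob_space M" "finite I"
    and [measurable]: "\<And>i. i \<in> I \<Longrightarrow> (\<lambda>w. X w i) \<in> borel_measurable M"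
      "\<And>i. i \<in> I \<Longrightarrow> (\<lambda>u. f u i) \<in> borel_measurable N"
  shows "(\<lambda>u. measure M {w \<in> space M. \<forall>i\<in>I. X w i \<le> f u i}) \<in> borel_measurable N"
proof -
  interpret prob_space M by fact
  define A where "A = {z \<in> space (N \<Otimes>\<^sub>M M). \<forall>i\<in>I. X (snd z) i \<le> f (fst z) i}"
  have "A \<in> sets (N \<Otimes>\<^sub>M M)"
    unfolding A_def using \<open>finite I\<close>
    by (intro sets.sets_Collect_finite_All borel_measurable_le
          measurable_compose[OF measurable_snd assms(3)] measurable_compose[OF measurable_fst assms(4)]) 
  then have "(\<lambda>u. measure M (Pair u -` A)) \<in> borel_measurable N"
    unfolding measure_def by (intro borel_measurable_enn2real measurable_emeasure_Pair)
  moreover have "Pair u -` A = {w \<in> space M. \<forall>i\<in>I. X w i \<le> f u i}" if "u \<in> space N" for u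
    using that by (auto simp: A_def space_pair_measure)
  ultimately show ?thesis by (simp cong: measurable_cong)
qed

section \<open>The order map\<close>

text \<open>The minimum is attained at \<open>J = {1..k}\<close>. Every other set of
  \<open>k\<close> indices has a largest index of at least \<open>k\<close>, so its maximum is no
  smaller than \<open>x k\<close>.\<close>

lemma order_map_eq_self:
  fixes x :: "nat \<Rightarrow> 'a::linorder"
  assumes x: "mono_on {1..d} x" and k: "k \<in> {1..d}"
  shows "order_map d x k = x k"
proof -
  let ?J = "{J. J \<subseteq> {1..d} \<and> card J = k}"
  have "finite ?J" by (rule finite_subset[of _ "Pow {1..d}"]) auto
  moreover have "x k \<le> Max (x ` J)" if J: "J \<in> ?J" for J
  proof -
    have fin: "finite J" and ne: "J \<noteq> {}"
      using J k by (auto intro: finite_subset[of _ "{Suc 0..d}"])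
    have "J \<subseteq> {1..Max J}" using J fin by auto
    then have "card J \<le> Max J" by (metis card_atLeastAtMost card_mono diff_Suc_1 finite_atLeastAtMost)
    moreover have "Max J \<in> J" using fin ne by auto
    ultimately have "x k \<le> x (Max J)"
      using J k x by (auto simp: mono_on_def)
    also have "\<dots> \<le> Max (x ` J)" using fin \<open>Max J \<in> J\<close> by auto
    finally show ?thesis .
  qed
  moreover have "x k \<in> (\<lambda>J. Max (x ` J)) ` ?J"
  proof (rule image_eqI)
    show "{1..k} \<in> ?J" using k by auto
    show "x k = Max (x ` {1..k})"
      by (rule Max_eqI[symmetric]) (use k x in \<open>auto simp: mono_on_def\<close>)
  qed
  ultimately have "Min ((\<lambda>J. Max (x ` J)) ` ?J) = x k"
    by (intro Min_eqI) auto
  then show ?thesis using k by (simp add: order_map_def)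
qed

text \<open>A permutation maps the family of \<open>k\<close>-element subsets onto itself, so the
  minimum runs over the same maxima.\<close>

lemma order_map_permute:
  assumes p: "p permutes {1..d}"
  shows "order_map d (x \<circ> p) = order_map d x"
proof -
  have "(\<lambda>J. Max ((x \<circ> p) ` J)) ` {J. J \<subseteq> {1..d} \<and> card J = k}
      = (\<lambda>J. Max (x ` J)) ` (image p ` {J. J \<subseteq> {1..d} \<and> card J = k})" for k
    by (simp add: image_image image_comp)
  moreover have "image p ` {J. J \<subseteq> {1..d} \<and> card J = k} = {J. J \<subseteq> {1..d} \<and> card J = k}" for k
  proof (intro equalityI subsetI)
    fix J assume "J \<in> image p ` {J. J \<subseteq> {1..d} \<and> card J = k}"
    then show "J \<in> {J. J \<subseteq> {1..d} \<and> card J = k}"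
      using permutes_image[OF p] permutes_inj[OF p] by (auto simp: card_image inj_on_subset)
  next
    fix J assume J: "J \<in> {J. J \<subseteq> {1..d} \<and> card J = k}"
    have q: "inv p permutes {1..d}" by (rule permutes_inv[OF p])
    have "J = p ` (inv p ` J)" using permutes_surj[OF p] by (simp add: image_f_inv_f)
    moreover have "inv p ` J \<subseteq> {1..d}" using permutes_image[OF q] J by blast
    moreover have "card (inv p ` J) = card J"
      using permutes_inj[OF q] by (simp add: card_image inj_on_subset)
    ultimately show "J \<in> image p ` {J. J \<subseteq> {1..d} \<and> card J = k}" using J by blast
  qed
  ultimately show ?thesis unfolding order_map_def by simp
qed

lemma order_map_eq_sorted:
  fixes x :: "nat \<Rightarrow> 'a::linorder"
  assumes "p permutes {1..d}" "mono_on {1..d} (x \<circ> p)"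
  shows "order_map d x = (\<lambda>k\<in>{1..d}. x (p k))"
proof -
  have "order_map d x = order_map d (x \<circ> p)" using assms(1) by (simp add: order_map_permute)
  also have "\<dots> = (\<lambda>k\<in>{1..d}. x (p k))"
    using order_map_eq_self[OF assms(2)] by (auto simp: order_map_def restrict_def)
  finally show ?thesis .
qed

lemma sorting_permutation_exists:
  fixes x :: "nat \<Rightarrow> 'a::linorder"
  shows "\<exists>p. p permutes {1..d} \<and> mono_on {1..d} (x \<circ> p)"
proof -
  define xs where "xs = sort_key x [1..<Suc d]"
  \<comment> \<open>List positions start at 0 while coordinates start at 1, hence the shift; outside
    the index range a permutation has to be the identity.\<close>
  define p where "p = (\<lambda>i. if i \<in> {1..d} then xs ! (i - 1) else i)"
  have xs: "distinct xs" "length xs = d" "set xs = {1..d}" "sorted (map x xs)"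
    by (auto simp: xs_def)
  have "p permutes {1..d}"
  proof (rule bij_imp_permutes)
    have "inj_on p {1..d}"
      using xs by (auto simp: inj_on_def p_def nth_eq_iff_index_eq)
    moreover have "p ` {1..d} \<subseteq> {1..d}"
      using xs nth_mem by (fastforce simp: p_def)
    ultimately show "bij_betw p {1..d} {1..d}"
      by (simp add: bij_betw_def endo_inj_surj)
  qed (unfold p_def, rule if_not_P)
  moreover have "mono_on {1..d} (x \<circ> p)"
  proof (rule mono_onI)
    fix i j assume ij: "i \<in> {1..d}" "j \<in> {1..d}" "i \<le> j"
    then have "i - 1 \<le> j - 1" "j - 1 < length xs" unfolding xs(2) by auto
    then have "map x xs ! (i - 1) \<le> map x xs ! (j - 1)"
      using xs(4) by (intro sorted_nth_mono) auto
    then show "(x \<circ> p) i \<le> (x \<circ> p) j" using ij xs(2) by (simp add: p_def)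
  qed
  ultimately show ?thesis by blast
qed

text \<open>The embedding of the reals is monotone, so one permutation sorts both vectors.\<close>

lemma order_map_ereal_vec: "order_map d (ereal_vec d u) = ereal_vec d (order_map d u)"
proof -
  obtain p where p: "p permutes {1..d}" "mono_on {1..d} (u \<circ> p)"
    using sorting_permutation_exists by blast
  have "mono_on {1..d} (ereal_vec d u \<circ> p)"
    using p permutes_in_image[OF p(1)] by (auto simp: mono_on_def ereal_vec_def)
  then have "order_map d (ereal_vec d u) = (\<lambda>k\<in>{1..d}. ereal_vec d u (p k))"
    by (rule order_map_eq_sorted[OF p(1)])
  also have "\<dots> = ereal_vec d (order_map d u)"
    unfolding order_map_eq_sorted[OF p]
    unfolding ereal_vec_def by (rule restrict_ext) (simp only: permutes_in_image[OF p(1)] restrict_apply if_True)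
  finally show ?thesis .
qed

lemma order_map_in_image:
  fixes u :: "nat \<Rightarrow> 'a::linorder"
  assumes "k \<in> {1..d}"
  shows "order_map d u k \<in> u ` {1..d}"
proof -
  obtain p where p: "p permutes {1..d}" "mono_on {1..d} (u \<circ> p)"
    using sorting_permutation_exists by blast
  then show ?thesis
    using assms permutes_in_image[OF p(1)] by (simp add: order_map_eq_sorted[OF p])
qed

lemma order_map_in_cube: "u \<in> cube d \<Longrightarrow> order_map d u \<in> cube d"
proof -
  assume "u \<in> cube d"
  then have "order_map d u k \<in> {0..1}" if "k \<in> {1..d}" for k
    using order_map_in_image[OF that, of u] unfolding cube_def by (auto dest: PiE_mem)
  moreover have "order_map d u \<in> extensional {1..d}" by (simp add: order_map_def)
  ultimately show "order_map d u \<in> cube d" unfolding cube_def by (simp add: PiE_iff)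
qed

text \<open>Values of the order map are sorted, and sorted vectors are its fixed points. The
  description by coordinate comparisons also makes the integration domain visibly
  measurable.\<close>

lemma order_map_image_cube: "order_map d ` cube d = {u \<in> cube d. mono_on {1..d} u}"
proof (intro equalityI subsetI)
  fix u assume "u \<in> order_map d ` cube d"
  then obtain v where v: "v \<in> cube d" "u = order_map d v" by auto
  obtain p where p: "p permutes {1..d}" "mono_on {1..d} (v \<circ> p)"
    using sorting_permutation_exists by blast
  have "mono_on {1..d} u"
    using p(2) by (auto simp: v(2) order_map_eq_sorted[OF p] mono_on_def)
  then show "u \<in> {u \<in> cube d. mono_on {1..d} u}" using v order_map_in_cube by auto
next
  fix u assume u: "u \<in> {u \<in> cube d. mono_on {1..d} u}"
  then have "order_map d u = u"
    using order_map_eq_self[of d u] by (auto simp: cube_def order_map_def PiE_iff extensional_def fun_eq_iff)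
  then show "u \<in> order_map d ` cube d" using u by (metis (mono_tags, lifting) imageI mem_Collect_eq)
qed

text \<open>This is the pointwise form of the factor \<open>d!\<close>: when the coordinates are
  distinct, one permutation alone brings \<open>v\<close> into the sorted region, so a single
  summand survives.\<close>

lemma order_map_sum_permutations:
  fixes f :: "(nat \<Rightarrow> real) \<Rightarrow> real"
  assumes v: "v \<in> cube d" "inj_on v {1..d}"
  shows "(\<Sum>p | p permutes {1..d}. indicator (order_map d ` cube d) (\<lambda>k\<in>{1..d}. v (p k))
            * f (\<lambda>k\<in>{1..d}. v (p k))) = f (order_map d v)"
proof -
  obtain q where q: "q permutes {1..d}" "mono_on {1..d} (v \<circ> q)"
    using sorting_permutation_exists by blast
  have ind: "indicator (order_map d ` cube d) (\<lambda>k\<in>{1..d}. v (p k)) = (of_bool (p = q) :: real)"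
    if p: "p permutes {1..d}" for p
  proof -
    have cube: "(\<lambda>k\<in>{1..d}. v (p k)) \<in> cube d"
      using v(1) permutes_in_image[OF p] by (auto simp: cube_def PiE_iff)
    \<comment> \<open>Two sorting permutations produce the same vector, the order map of
      \<open>v\<close>; injectivity of \<open>v\<close> then identifies the permutations.\<close>
    have "p = q" if "mono_on {1..d} (v \<circ> p)"
    proof (rule ext)
      fix k show "p k = q k"
      proof (cases "k \<in> {1..d}")
        case True
        have "(\<lambda>k\<in>{1..d}. v (p k)) = (\<lambda>k\<in>{1..d}. v (q k))"
          using order_map_eq_sorted[OF p that] order_map_eq_sorted[OF q] by simp
        then have "v (p k) = v (q k)" using True by (metis restrict_apply')
        then show ?thesis
          using v(2) True permutes_in_image[OF p] permutes_in_image[OF q(1)] by (auto dest: inj_onD)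
      qed (use p q in \<open>auto simp: permutes_def\<close>)
    qed
    moreover have "mono_on {1..d} (\<lambda>k\<in>{1..d}. v (p k)) \<longleftrightarrow> mono_on {1..d} (v \<circ> p)"
      by (auto simp: mono_on_def)
    ultimately have "mono_on {1..d} (\<lambda>k\<in>{1..d}. v (p k)) \<longleftrightarrow> p = q" using q(2) by blast
    then show ?thesis using cube unfolding order_map_image_cube indicator_def by simp
  qed
  have "(\<Sum>p | p permutes {1..d}. indicator (order_map d ` cube d) (\<lambda>k\<in>{1..d}. v (p k))
            * f (\<lambda>k\<in>{1..d}. v (p k)))
      = (\<Sum>p | p permutes {1..d}. if q = p then f (order_map d v) else 0)"
  proof (intro sum.cong refl)
    fix p assume "p \<in> {p. p permutes {1..d}}"
    then have p: "p permutes {1..d}" by simp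
    show "indicator (order_map d ` cube d) (\<lambda>k\<in>{1..d}. v (p k)) * f (\<lambda>k\<in>{1..d}. v (p k))
        = (if q = p then f (order_map d v) else 0)"
      unfolding ind[OF p] order_map_eq_sorted[OF q] by auto
  qed
  then show ?thesis using q(1) by (simp add: finite_permutations)
qed

lemma measurable_order_map:
  "order_map d \<in> measurable (ext_space d) (ext_space d)"
proof -
  have fin: "finite {J. J \<subseteq> {1..d} \<and> card J = k}" for k
    by (rule finite_subset[of _ "Pow {1..d}"]) auto
  show ?thesis
    unfolding order_map_def
    by (intro measurable_restrict borel_measurable_Min borel_measurable_Max fin measurable_component_singleton)
      (auto intro: finite_subset[of _ "{Suc 0..d}"])
qed

section \<open>The uniform distribution on the cube\<close>

text \<open>Otherwise the simplifier turns \<open>{1..d}\<close> into \<open>{Suc 0..d}\<close>, where facts about \<open>{1..d}\<close> no longer match.\<close>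

declare One_nat_def [simp del]

text \<open>Lebesgue measure on the cube, written as a product of uniform laws so that independence
  and reindexing of coordinates are available. \<open>copula_measure_product\<close> identifies it
  with the measure of the product copula.\<close>

definition unif :: "nat \<Rightarrow> (nat \<Rightarrow> real) measure" where
  "unif d = Pi\<^sub>M {1..d} (\<lambda>_. restrict_space lborel {0..1})"

lemma prob_space_unit_interval: "prob_space (restrict_space lborel {0..1::real})"
  by (rule prob_spaceI) (simp add: emeasure_restrict_space space_restrict_space)

lemma prob_space_unif: "prob_space (unif d)"
  unfolding unif_def by (intro prob_space_PiM prob_space_unit_interval)

lemma sets_unif [measurable_cong]:
  "sets (unif d) = sets (Pi\<^sub>M {1..d} (\<lambda>_. restrict_space borel {0..1}))"
  unfolding unif_def by (intro sets_PiM_cong sets_restrict_space_cong) auto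

lemma space_unif: "space (unif d) = cube d"
  by (simp add: unif_def space_PiM space_restrict_space cube_def)

lemma measurable_unif_component [measurable]:
  assumes "k \<in> {1..d}"
  shows "(\<lambda>v. v k) \<in> borel_measurable (unif d)"
proof -
  have "(\<lambda>v. v k) \<in> measurable (unif d) (restrict_space lborel {0..1})"
    unfolding unif_def using assms by (rule measurable_component_singleton)
  then show ?thesis by (simp add: measurable_restrict_space2_iff)
qed

lemma measurable_order_map_unif [measurable]:
  assumes "k \<in> {1..d}"
  shows "(\<lambda>v. order_map d v k) \<in> borel_measurable (unif d)"
proof -
  have fin: "finite {J. J \<subseteq> {1..d} \<and> card J = k}" for k
    by (rule finite_subset[of _ "Pow {1..d}"]) auto
  then have "(\<lambda>v. Min ((\<lambda>J. Max (v ` J)) ` {J. J \<subseteq> {1..d} \<and> card J = k}))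
      \<in> borel_measurable (unif d)"
    by (intro borel_measurable_Min borel_measurable_Max fin measurable_unif_component)
      (auto intro: finite_subset[of _ "{1..d}"])
  then show ?thesis using assms by (simp add: order_map_def)
qed

lemma measurable_ereal_vec:
  assumes "\<And>k. k \<in> {1..d} \<Longrightarrow> (\<lambda>w. f w k) \<in> borel_measurable M"
  shows "(\<lambda>w. ereal_vec d (f w)) \<in> measurable M (ext_space d)"
  unfolding ereal_vec_def using assms by (intro measurable_restrict borel_measurable_ereal)

lemma measure_unif_lower_box:
  assumes "u \<in> cube d"
  shows "measure (unif d) {v \<in> cube d. \<forall>k\<in>{1..d}. v k \<le> u k} = (\<Prod>k\<in>{1..d}. u k)"
proof -
  interpret U: prob_space "restrict_space lborel {0..1::real}"
    by (rule prob_space_unit_interval)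
  interpret finite_product_prob_space "\<lambda>_. restrict_space lborel {0..1::real}" "{1..d}"
    by unfold_locales auto
  have u: "0 \<le> u k" "u k \<le> 1" if "k \<in> {1..d}" for k
    using assms that by (auto simp: cube_def PiE_iff)
  have "{v \<in> cube d. \<forall>k\<in>{1..d}. v k \<le> u k} = (\<Pi>\<^sub>E k\<in>{1..d}. {0..u k})"
    by (simp add: set_eq_iff cube_def PiE_iff) (meson order.trans u(2))
  moreover have "measure (unif d) (\<Pi>\<^sub>E k\<in>{1..d}. {0..u k})
      = (\<Prod>k\<in>{1..d}. measure (restrict_space lborel {0..1}) {0..u k})"
    unfolding unif_def
  proof (rule finite_measure_PiM_emb)
    show "{0..u k} \<in> sets (restrict_space lborel {0..1})" if "k \<in> {1..d}" for k
      using u[OF that] by (subst sets_restrict_space_iff) auto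
  qed
  moreover have "measure (restrict_space lborel {0..1}) {0..u k} = u k" if "k \<in> {1..d}" for k
    using u[OF that] by (subst measure_restrict_space) auto
  ultimately show ?thesis by simp
qed

lemma copula_measure_product: "copula_measure d (product_copula d) = unif d"
  by (rule copula_measure_eqI)
    (auto simp: prob_space_unif sets_unif measure_unif_lower_box product_copula_def)

text \<open>Extending the copula by clipping corresponds to viewing a uniform point of the cube as a
  point of the extended space.\<close>

lemma dist_measure_product:
  "dist_measure d (copula_ext d (product_copula d)) = distr (unif d) (ext_space d) (ereal_vec d)"
proof (rule dist_measure_eqI)
  interpret prob_space "unif d" by (rule prob_space_unif)
  have meas: "ereal_vec d \<in> measurable (unif d) (ext_space d)"
    by (rule measurable_ereal_vec) simp
  show "prob_space (distr (unif d) (ext_space d) (ereal_vec d))"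
    by (rule prob_space_distr) (rule meas)
  fix x :: "nat \<Rightarrow> ereal" assume x: "x \<in> {1..d} \<rightarrow>\<^sub>E UNIV"
  define u where "u = (\<lambda>k\<in>{1..d}. clip (x k))"
  have clip: "0 \<le> clip t" "clip t \<le> 1" for t
    by (cases t; auto simp: clip_def max_def min_def)+
  have u: "u \<in> cube d" using clip by (auto simp: u_def cube_def)
  have "{y \<in> {1..d} \<rightarrow>\<^sub>E UNIV. \<forall>k\<in>{1..d}. y k \<le> x k} \<in> sets (ext_space d)"
  proof -
    have "{y \<in> space (ext_space d). \<forall>k\<in>{1..d}. y k \<le> x k} \<in> sets (ext_space d)"
      by measurable
    then show ?thesis by (simp add: space_PiM)
  qed
  then have "dist_fun d (distr (unif d) (ext_space d) (ereal_vec d)) x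
      = measure (unif d) {v \<in> cube d. \<forall>k\<in>{1..d}. ereal (v k) \<le> x k}"
    using x meas
    by (auto simp: dist_fun_def measure_distr space_unif ereal_vec_def intro!: arg_cong[where f="measure _"])
  also have "\<dots> = (\<Prod>k\<in>{1..d}. clip (x k))"
  \<comment> \<open>With a negative coordinate the box misses the cube and the matching factor is
    \<open>clip (x k) = 0\<close>. Otherwise clipping can only lower a coordinate of the corner to
    1, which no point of the cube notices.\<close>
  proof (cases "\<exists>k\<in>{1..d}. x k < 0")
    case True
    then obtain k where k: "k \<in> {1..d}" "x k < 0" by auto
    then have "clip (x k) = 0" by (cases "x k") (auto simp: clip_def max_def min_def)
    moreover have "\<not> ereal (v k) \<le> x k" if "v \<in> cube d" for v
    proof -
      have "0 \<le> v k" using that k(1) unfolding cube_def by (auto dest: PiE_mem)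
      then show ?thesis using k(2) by (cases "x k") auto
    qed
    then have "{v \<in> cube d. \<forall>k\<in>{1..d}. ereal (v k) \<le> x k} = {}" using k by blast
    ultimately show ?thesis using k by (metis finite_atLeastAtMost measure_empty prod_zero)
  next
    case False
    have "ereal (v k) \<le> x k \<longleftrightarrow> v k \<le> u k" if "v \<in> cube d" "k \<in> {1..d}" for v k
    proof -
      have "0 \<le> v k" "v k \<le> 1" using that unfolding cube_def by (auto dest: PiE_mem)
      moreover have "0 \<le> x k" using that False by (auto simp: not_less)
      ultimately show ?thesis
        using that(2) by (cases "x k") (auto simp: u_def clip_def max_def min_def)
    qed
    then have "{v \<in> cube d. \<forall>k\<in>{1..d}. ereal (v k) \<le> x k} = {v \<in> cube d. \<forall>k\<in>{1..d}. v k \<le> u k}"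
      by auto
    then show ?thesis using measure_unif_lower_box[OF u] by (simp add: u_def)
  qed
  also have "\<dots> = copula_ext d (product_copula d) x"
    using x u by (simp add: copula_ext_def product_copula_def u_def)
  finally show "dist_fun d (distr (unif d) (ext_space d) (ereal_vec d)) x
      = copula_ext d (product_copula d) x" .
qed simp

text \<open>The order map commutes with the embedding of the cube, so sorting can be done on real
  vectors first.\<close>

lemma distr_order_map_product:
  "distr (dist_measure d (copula_ext d (product_copula d))) (ext_space d) (order_map d)
     = distr (unif d) (ext_space d) (\<lambda>v. ereal_vec d (order_map d v))"
  unfolding dist_measure_product
  by (subst distr_distr[OF measurable_order_map measurable_ereal_vec])
    (auto simp: comp_def order_map_ereal_vec)

lemma copula_ext_T_product:
  assumes x: "x \<in> {1..d} \<rightarrow>\<^sub>E UNIV"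
  shows "copula_ext_T d (product_copula d) x
    = measure (unif d) {v \<in> space (unif d). \<forall>k\<in>{1..d}. ereal (order_map d v k) \<le> x k}"
proof -
  have "{y \<in> space (ext_space d). \<forall>k\<in>{1..d}. y k \<le> x k} \<in> sets (ext_space d)"
    by measurable
  then show ?thesis
    using x measurable_ereal_vec[of d "order_map d" "unif d"]
    by (auto simp: copula_ext_T_def distr_order_map_product dist_fun_def measure_distr space_PiM
        ereal_vec_def intro!: arg_cong[where f="measure _"])
qed

lemma dist_measure_copula_ext_T_product:
  "dist_measure d (copula_ext_T d (product_copula d))
     = distr (unif d) (ext_space d) (\<lambda>v. ereal_vec d (order_map d v))"
  unfolding copula_ext_T_def distr_order_map_product
  by (rule dist_measure_eqI)
    (auto intro!: prob_space.prob_space_distr prob_space_unif measurable_ereal_vec)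

section \<open>Almost sure absence of fixed values and of ties\<close>

lemma AE_unif_component_neq:
  assumes "k \<in> {1..d}"
  shows "AE v in unif d. v k \<noteq> t"
proof -
  have "AE x in restrict_space lborel {0..1}. x \<noteq> t"
    by (subst AE_restrict_space_iff) (use AE_lborel_singleton[of t] in auto)
  then have "AE x in distr (unif d) (restrict_space lborel {0..1}) (\<lambda>v. v k). x \<noteq> t"
    unfolding unif_def using assms
    by (subst distr_PiM_component) (auto simp: prob_space_unit_interval)
  then show ?thesis
    by (rule AE_distrD[rotated]) (use assms in \<open>auto simp: unif_def\<close>)
qed

lemma AE_unif_order_map_neq:
  assumes "k \<in> {1..d}"
  shows "AE v in unif d. order_map d v k \<noteq> t"
proof -
  have "AE v in unif d. \<forall>l\<in>{1..d}. v l \<noteq> t"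
    by (intro AE_finite_allI AE_unif_component_neq) auto
  then show ?thesis
  proof eventually_elim
    case (elim v)
    then show ?case using order_map_in_image[OF assms, of v] by (metis imageE)
  qed
qed

text \<open>By Fubini: once all coordinates other than \<open>i\<close> are fixed, a tie confines
  coordinate \<open>i\<close> to the single point \<open>x j\<close>, which is a null set.\<close>

lemma AE_unif_neq:
  assumes "i \<in> {1..d}" "j \<in> {1..d}" "i \<noteq> j"
  shows "AE v in unif d. v i \<noteq> v j"
proof -
  let ?U = "restrict_space lborel {0..1::real}"
  let ?I = "{1..d} - {i}"
  interpret U: prob_space ?U by (rule prob_space_unit_interval)
  interpret product_sigma_finite "\<lambda>_::nat. ?U" by unfold_locales
  have I: "insert i ?I = {1..d}" using assms by auto
  define A where "A = {v \<in> space (unif d). v i = v j}"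
  have A: "A \<in> sets (unif d)"
    unfolding A_def using assms by measurable
  have "emeasure (unif d) A = (\<integral>\<^sup>+v. indicator A v \<partial>Pi\<^sub>M (insert i ?I) (\<lambda>_. ?U))"
    using A unfolding I unif_def by simp
  also have "\<dots> = (\<integral>\<^sup>+x. (\<integral>\<^sup>+y. indicator A (x(i := y)) \<partial>?U) \<partial>Pi\<^sub>M ?I (\<lambda>_. ?U))"
    by (rule product_nn_integral_insert) (use A in \<open>auto simp: unif_def insert_absorb[OF assms(1)]\<close>)
  also have "\<dots> = (\<integral>\<^sup>+x. 0 \<partial>Pi\<^sub>M ?I (\<lambda>_. ?U))"
  proof (intro nn_integral_cong)
    fix x :: "nat \<Rightarrow> real"
    have "AE y in ?U. y \<noteq> x j"
      by (subst AE_restrict_space_iff) (use AE_lborel_singleton[of "x j"] in auto)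
    then have "AE y in ?U. indicator A (x(i := y)) = (0::ennreal)"
      by (rule AE_mp) (use assms in \<open>auto simp: A_def intro!: AE_I2\<close>)
    then show "(\<integral>\<^sup>+y. indicator A (x(i := y)) \<partial>?U) = 0"
      by (subst nn_integral_cong_AE) auto
  qed
  finally have "A \<in> null_sets (unif d)" using A by auto
  then show ?thesis
    by (rule AE_I') (auto simp: A_def)
qed

lemma AE_unif_inj_on: "AE v in unif d. inj_on v {1..d}"
proof -
  have "AE v in unif d. \<forall>i\<in>{1..d}. \<forall>j\<in>{1..d}. i \<noteq> j \<longrightarrow> v i \<noteq> v j"
    by (intro AE_finite_allI) (auto intro: AE_unif_neq)
  then show ?thesis by (rule AE_mp) (auto simp: inj_on_def)
qed

section \<open>Cube-valued maps and symmetrization over permutations\<close>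

lemma cubeD: "u \<in> cube n \<Longrightarrow> k \<in> {1..n} \<Longrightarrow> 0 \<le> u k \<and> u k \<le> 1"
  unfolding cube_def by (drule (1) PiE_mem) simp

lemma measurable_cube_component:
  assumes "k \<in> {1..n}"
  shows "(\<lambda>u. u k) \<in> borel_measurable (Pi\<^sub>M {1..n} (\<lambda>_. restrict_space borel {0..1::real}))"
  using measurable_component_singleton[OF assms, of "\<lambda>_. restrict_space borel {0..1::real}"]
  by (simp add: measurable_restrict_space2_iff)

lemma measurable_cubeI:
  assumes "\<And>k. k \<in> {1..n} \<Longrightarrow> (\<lambda>w. f w k) \<in> borel_measurable M"
    and "\<And>w. w \<in> space M \<Longrightarrow> f w \<in> cube n"
  shows "f \<in> measurable M (Pi\<^sub>M {1..n} (\<lambda>_. restrict_space borel {0..1}))"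
proof (rule measurable_PiM_single')
  show "(\<lambda>w. f w k) \<in> measurable M (restrict_space borel {0..1})" if "k \<in> {1..n}" for k
    using assms(1)[OF that] assms(2) that
    by (intro measurable_restrict_space2) (use cubeD in force)+
  show "(\<lambda>w k. f w k) \<in> space M \<rightarrow> (\<Pi>\<^sub>E k\<in>{1..n}. space (restrict_space borel {0..1}))"
    using assms(2) by (auto simp: cube_def space_restrict_space)
qed

text \<open>Integrating \<open>order_map_sum_permutations\<close> gives \<open>d!\<close> integrals,
  all equal because permuting coordinates preserves the uniform law. The bound \<open>B\<close>
  yields the integrability needed to exchange sum and integral.\<close>

lemma unif_symmetrize:
  fixes f :: "(nat \<Rightarrow> real) \<Rightarrow> real"
  assumes f [measurable]: "f \<in> borel_measurable (unif d)" and bound: "\<And>u. u \<in> cube d \<Longrightarrow> \<bar>f u\<bar> \<le> B"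
  shows "(\<integral>v. f (order_map d v) \<partial>unif d) = fact d * (LINT u : order_map d ` cube d | unif d. f u)"
proof -
  interpret prob_space "unif d" by (rule prob_space_unif)
  define S where "S = order_map d ` cube d"
  define g where "g u = indicator S u * f u" for u
  let ?act = "\<lambda>p v. \<lambda>k\<in>{1..d}. v (p k)"
  \<comment> \<open>Sortedness amounts to finitely many comparisons of coordinates, hence
    \<open>S\<close> is measurable.\<close>
  have "S = {u \<in> space (unif d). \<forall>i\<in>{1..d}. \<forall>j\<in>{1..d}. i \<le> j \<longrightarrow> u i \<le> u j}"
    unfolding S_def order_map_image_cube space_unif
    by (intro Collect_cong conj_cong refl) (simp only: mono_on_def Ball_def; blast)
  also have "\<dots> \<in> sets (unif d)"
  proof (intro sets.sets_Collect_finite_All finite_atLeastAtMost)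
    fix i j assume "i \<in> {1..d}" "j \<in> {1..d}"
    then show "{u \<in> space (unif d). i \<le> j \<longrightarrow> u i \<le> u j} \<in> sets (unif d)"
      by (cases "i \<le> j") (auto intro!: borel_measurable_le measurable_unif_component)
  qed
  finally have [measurable]: "S \<in> sets (unif d)" .
  have g [measurable]: "g \<in> borel_measurable (unif d)"
    unfolding g_def by measurable
  have int_g: "integrable (unif d) g"
  proof (rule integrable_const_bound[where B=B])
    show "AE u in unif d. norm (g u) \<le> B"
    proof (rule AE_I2)
      fix u assume "u \<in> space (unif d)"
      then have "\<bar>f u\<bar> \<le> B" using bound by (simp add: space_unif)
      then show "norm (g u) \<le> B" by (auto simp: g_def indicator_def)
    qed
  qed (rule g)
  have act: "?act p \<in> measurable (unif d) (unif d)" "distr (unif d) (unif d) (?act p) = unif d"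
    if p: "p permutes {1..d}" for p
  proof -
    have in_p: "p k \<in> {1..d}" if "k \<in> {1..d}" for k
      using that permutes_in_image[OF p] by blast
    have "?act p \<in> measurable (unif d) (Pi\<^sub>M {1..d} (\<lambda>_. restrict_space borel {0..1}))"
      using in_p by (intro measurable_cubeI) (auto simp: space_unif cube_def PiE_iff)
    then show "?act p \<in> measurable (unif d) (unif d)"
      by (simp add: measurable_cong_sets[OF refl sets_unif])
    show "distr (unif d) (unif d) (?act p) = unif d"
      unfolding unif_def
      by (rule distr_PiM_reindex)
        (use in_p permutes_inj_on[OF p] in \<open>auto simp: prob_space_unit_interval\<close>)
  qed
  have order_map [measurable]: "order_map d \<in> measurable (unif d) (unif d)"
    unfolding measurable_cong_sets[OF refl sets_unif]
    by (rule measurable_cubeI) (auto simp: space_unif order_map_in_cube)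
  have g_act: "(\<lambda>v. g (?act p v)) \<in> borel_measurable (unif d)"
    "integrable (unif d) (\<lambda>v. g (?act p v))"
    "(\<integral>v. g (?act p v) \<partial>unif d) = (\<integral>v. g v \<partial>unif d)" if p: "p permutes {1..d}" for p
  proof -
    show "(\<lambda>v. g (?act p v)) \<in> borel_measurable (unif d)"
      by (rule measurable_compose[OF act(1)[OF p] g])
    show "integrable (unif d) (\<lambda>v. g (?act p v))"
      by (rule integrable_distr[OF act(1)[OF p]]) (simp only: act(2)[OF p] int_g)
    show "(\<integral>v. g (?act p v) \<partial>unif d) = (\<integral>v. g v \<partial>unif d)"
      using integral_distr[OF act(1)[OF p] g] by (simp only: act(2)[OF p])
  qed
  have "(\<integral>v. f (order_map d v) \<partial>unif d) = (\<integral>v. (\<Sum>p | p permutes {1..d}. g (?act p v)) \<partial>unif d)"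
  proof (rule integral_cong_AE)
    show "(\<lambda>v. \<Sum>p | p permutes {1..d}. g (?act p v)) \<in> borel_measurable (unif d)"
      using g_act(1) by (intro borel_measurable_sum) blast
    show "AE v in unif d. f (order_map d v) = (\<Sum>p | p permutes {1..d}. g (?act p v))"
      using AE_unif_inj_on AE_space
    proof eventually_elim
      case (elim v)
      then show ?case
        using order_map_sum_permutations[of v d f] by (simp only: g_def S_def space_unif)
    qed
  qed measurable
  also have "\<dots> = (\<Sum>p | p permutes {1..d}. (\<integral>v. g (?act p v) \<partial>unif d))"
    using g_act(2) by (intro Bochner_Integration.integral_sum) blast
  also have "\<dots> = (\<Sum>p | p permutes {1..d}. (\<integral>v. g v \<partial>unif d))"
    using g_act(3) by (intro sum.cong) auto
  also have "\<dots> = fact d * (\<integral>v. g v \<partial>unif d)"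
    by (simp add: card_permutations)
  finally show ?thesis by (simp add: g_def S_def set_lebesgue_integral_def)
qed

section \<open>Distribution functions as copulas\<close>

text \<open>Without atoms the distribution function \<open>G\<close> of \<open>X\<close> is
  continuous; it runs from 0 to 1 on the unit interval, so the intermediate value theorem gives the
  first claim. The second is obtained by sandwiching the event \<open>G X <= s\<close> between
  events \<open>X <= t\<close>. This avoids inverting \<open>G\<close>, which may be constant on
  intervals.\<close>

lemma
  fixes X :: "'a \<Rightarrow> real" and M :: "'a measure"
  assumes "prob_space M" and X [measurable]: "X \<in> borel_measurable M"
    and range: "\<And>w. w \<in> space M \<Longrightarrow> X w \<in> {0..1}"
    and atomless: "\<And>t. AE w in M. X w \<noteq> t"
    and s: "s \<in> {0..1}"
  shows distribution_function_attains: "\<exists>t. measure M {w \<in> space M. X w \<le> t} = s"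
    and probability_integral_transform:
      "measure M {w \<in> space M. measure M {w' \<in> space M. X w' \<le> X w} \<le> s} = s"
proof -
  interpret prob_space M by fact
  define D where "D = distr M borel X"
  interpret D: real_distribution D
    unfolding D_def by (rule real_distribution_distr) simp
  define G where "G t = measure M {w \<in> space M. X w \<le> t}" for t
  have cdf: "cdf D = G"
    by (auto simp: fun_eq_iff cdf_def D_def G_def measure_distr intro!: arg_cong[where f="measure _"])
  have "measure D {t} = 0" for t
  proof -
    have "measure D {t} = measure M {w \<in> space M. X w = t}"
      by (auto simp: D_def measure_distr intro!: arg_cong[where f="measure _"])
    also have "\<dots> = 0"
      using atomless[of t] by (subst measure_eq_0_null_sets) (auto simp: AE_iff_null)
    finally show ?thesis .
  qed
  then have cont: "isCont G t" for t
    using D.isCont_cdf by (simp add: cdf)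
  have mono: "G t \<le> G t'" if "t \<le> t'" for t t'
    using D.cdf_nondecreasing[OF that] by (simp add: cdf)
  have G_meas [measurable]: "G \<in> borel_measurable borel"
    using mono by (intro borel_measurable_mono) (auto simp: mono_def)
  have "AE w in M. \<not> X w \<le> 0"
    using atomless[of 0] AE_space by eventually_elim (use range in force)
  then have G0: "G 0 = 0"
    unfolding G_def by (subst measure_eq_0_null_sets) (auto simp: AE_iff_null)
  have "{w \<in> space M. X w \<le> 1} = space M"
    using range by auto
  then have G1: "G 1 = 1"
    unfolding G_def by (simp only: prob_space)
  have attains: "\<exists>t. G t = s" if "s \<in> {0..1}" for s
    using IVT[of G 0 s 1] that cont G0 G1 by auto
  from attains[OF s] show "\<exists>t. measure M {w \<in> space M. X w \<le> t} = s"
    by (simp add: G_def)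
  have ge: "s \<le> prob {w \<in> space M. G (X w) \<le> s}"
  proof -
    obtain t where t: "G t = s" using attains[OF s] by auto
    have "s = prob {w \<in> space M. X w \<le> t}" using t by (simp add: G_def)
    also have "\<dots> \<le> prob {w \<in> space M. G (X w) \<le> s}"
      using mono t by (intro finite_measure_mono) auto
    finally show ?thesis .
  qed
  \<comment> \<open>For a level \<open>r\<close> strictly between \<open>s\<close> and 1, attained
    as \<open>G t = r\<close>, having \<open>G X <= s\<close> forces \<open>X <= t\<close>. The
    probability is thus at most every such \<open>r\<close>, and letting \<open>r\<close> decrease
    to \<open>s\<close> gives the bound.\<close>
  have le: "prob {w \<in> space M. G (X w) \<le> s} \<le> s"
  proof (cases "s = 1")
    case False
    then have "s < 1" using s by auto
    then show ?thesis
    proof (rule dense_ge_bounded)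
      fix r assume r: "s < r" "r < 1"
      then obtain t where t: "G t = r" using attains[of r] s by auto
      have "prob {w \<in> space M. G (X w) \<le> s} \<le> prob {w \<in> space M. X w \<le> t}"
      proof (rule finite_measure_mono)
        show "{w \<in> space M. G (X w) \<le> s} \<subseteq> {w \<in> space M. X w \<le> t}"
          using mono t r by (smt (verit) Collect_mono)
      qed measurable
      then show "prob {w \<in> space M. G (X w) \<le> s} \<le> r" using t by (simp add: G_def)
    qed
  qed simp
  from ge le show "measure M {w \<in> space M. measure M {w' \<in> space M. X w' \<le> X w} \<le> s} = s"
    by (simp add: G_def)
qed

text \<open>The alternating sum is the expectation of a product of nonnegative factors, the
  indicators of \<open>u k < X k <= v k\<close>. The boundary conditions come from the uniform
  marginals, since a corner coordinate 1 imposes no constraint.\<close>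

lemma copula_distribution_function:
  fixes X :: "'a \<Rightarrow> nat \<Rightarrow> real"
  assumes "prob_space M" and meas [measurable]: "\<And>k. k \<in> {1..n} \<Longrightarrow> (\<lambda>w. X w k) \<in> borel_measurable M"
    and range: "\<And>w. w \<in> space M \<Longrightarrow> X w \<in> cube n"
    and uniform: "\<And>k s. k \<in> {1..n} \<Longrightarrow> s \<in> {0..1} \<Longrightarrow> measure M {w \<in> space M. X w k \<le> s} = s"
  shows "copula n (\<lambda>u\<in>cube n. measure M {w \<in> space M. \<forall>k\<in>{1..n}. X w k \<le> u k})"
proof -
  interpret prob_space M by fact
  define C where "C u = measure M {w \<in> space M. \<forall>k\<in>{1..n}. X w k \<le> u k}" for u
  have box [measurable]: "{w \<in> space M. \<forall>k\<in>{1..n}. X w k \<le> u k} \<in> sets M" for u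
    by measurable
  have cube_eta: "eta K u v \<in> cube n" if "u \<in> cube n" "v \<in> cube n" for K u v
    using that by (auto simp: cube_def PiE_iff override_on_def extensional_def)
  have const: "const_vec n c \<in> cube n" if "c \<in> {0..1}" for c
    using that by (auto simp: cube_def const_vec_def)
  have le1: "X w k \<le> 1" if "w \<in> space M" "k \<in> {1..n}" for w k
    using cubeD[OF range[OF that(1)] that(2)] by simp
  have "0 \<le> (\<Sum>K\<in>Pow {1..n}. (-1) ^ (n - card K) * C (eta K u v))"
    if "\<forall>k\<in>{1..n}. u k \<le> v k" for u v
  proof -
    \<comment> \<open>In the expansion of the product of differences, \<open>K\<close> collects the
      coordinates at which the upper end \<open>v\<close> is chosen; each of the remaining
      \<open>n - card K\<close> coordinates contributes a sign.\<close>
    let ?i = "\<lambda>a w k. of_bool (X w k \<le> a k) :: real"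
    have ind: "(\<Prod>k\<in>K. ?i v w k) * (\<Prod>k\<in>{1..n} - K. ?i u w k)
        = indicator {w \<in> space M. \<forall>k\<in>{1..n}. X w k \<le> eta K u v k} w"
      if "K \<in> Pow {1..n}" "w \<in> space M" for K w
    proof -
      have fin: "finite K" using that(1) by (auto intro: finite_subset[of _ "{1..n}"])
      have b: "(\<Prod>k\<in>A. of_bool (P k)) = (of_bool (\<forall>k\<in>A. P k) :: real)" if "finite A" for A :: "nat set" and P
        using that by (induction A rule: finite_induct) auto
      have "(\<forall>k\<in>K. X w k \<le> v k) \<and> (\<forall>k\<in>{1..n} - K. X w k \<le> u k)
          \<longleftrightarrow> (\<forall>k\<in>{1..n}. X w k \<le> eta K u v k)"
        using that(1) unfolding override_on_def by auto
      then show ?thesis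
        using that(2) fin by (simp add: b indicator_def flip: of_bool_conj)
    qed
    have "0 \<le> (\<integral>w. (\<Prod>k\<in>{1..n}. ?i v w k - ?i u w k) \<partial>M)"
    proof (intro integral_nonneg_AE AE_I2 prod_nonneg)
      show "0 \<le> ?i v w k - ?i u w k" if "k \<in> {1..n}" for w k
        using \<open>\<forall>k\<in>{1..n}. u k \<le> v k\<close> that by (auto intro: order_trans)
    qed
    also have "\<dots> = (\<integral>w. (\<Sum>K\<in>Pow {1..n}. (-1) ^ (n - card K)
        * indicator {w \<in> space M. \<forall>k\<in>{1..n}. X w k \<le> eta K u v k} w) \<partial>M)"
      using ind by (intro Bochner_Integration.integral_cong refl)
        (simp add: prod_diff_conv_sum' mult.assoc)
    also have "\<dots> = (\<Sum>K\<in>Pow {1..n}. (-1) ^ (n - card K) * C (eta K u v))"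
      unfolding C_def
      by (subst Bochner_Integration.integral_sum)
        (auto intro!: integrable_mult_right integrable_real_indicator emeasure_eq_measure
          simp: less_top[symmetric])
    finally show ?thesis .
  qed
  moreover have "C (eta {k} u (const_vec n 0)) = 0" if "k \<in> {1..n}" for u k
  proof -
    have "C (eta {k} u (const_vec n 0)) \<le> measure M {w \<in> space M. X w k \<le> 0}"
      unfolding C_def
    proof (rule finite_measure_mono)
      have "eta {k} u (const_vec n 0) k = 0" using that by (simp add: const_vec_def)
      then show "{w \<in> space M. \<forall>l\<in>{1..n}. X w l \<le> eta {k} u (const_vec n 0) l} \<subseteq> {w \<in> space M. X w k \<le> 0}"
        using that by (metis (mono_tags, lifting) Collect_mono)
    qed (use that in measurable)
    then show ?thesis using uniform[OF that, of 0] by (simp add: C_def order_antisym)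
  qed
  moreover have "C (eta {k} (const_vec n 1) u) = u k" if "u \<in> cube n" "k \<in> {1..n}" for u k
  proof -
    have "{w \<in> space M. \<forall>l\<in>{1..n}. X w l \<le> eta {k} (const_vec n 1) u l} = {w \<in> space M. X w k \<le> u k}"
    proof (intro Collect_cong conj_cong refl iffI ballI)
      fix w assume "w \<in> space M" "\<forall>l\<in>{1..n}. X w l \<le> eta {k} (const_vec n 1) u l"
      then show "X w k \<le> u k" using that(2) by fastforce
    next
      fix w l assume "w \<in> space M" "X w k \<le> u k" "l \<in> {1..n}"
      then show "X w l \<le> eta {k} (const_vec n 1) u l"
        using le1[of w l] by (cases "l = k") (simp_all add: const_vec_def)
    qed
    then show ?thesis
      using uniform[OF that(2), of "u k"] cubeD[OF that] by (simp add: C_def)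
  qed
  ultimately show ?thesis
    using cube_eta const[of 0] const[of 1] unfolding copula_def C_def[symmetric]
    by (auto simp: C_def)
qed

text \<open>This turns integrals against a copula measure into expectations of functions of
  \<open>X\<close>, by uniqueness of the measure with given lower-box values.\<close>

lemma copula_measure_distr:
  assumes "prob_space M" and meas: "\<And>k. k \<in> {1..n} \<Longrightarrow> (\<lambda>w. X w k) \<in> borel_measurable M"
    and range: "\<And>w. w \<in> space M \<Longrightarrow> X w \<in> cube n"
    and C: "\<And>u. u \<in> cube n \<Longrightarrow> C u = measure M {w \<in> space M. \<forall>k\<in>{1..n}. X w k \<le> u k}"
  shows "copula_measure n C = distr M (Pi\<^sub>M {1..n} (\<lambda>_. restrict_space borel {0..1})) X"
proof (rule copula_measure_eqI)
  let ?N = "Pi\<^sub>M {1..n} (\<lambda>_. restrict_space borel {0..1::real})"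
  interpret prob_space M by fact
  have X: "X \<in> measurable M ?N" using meas range by (rule measurable_cubeI)
  then show "prob_space (distr M ?N X)" by (rule prob_space_distr)
  fix u assume u: "u \<in> cube n"
  have space: "space ?N = cube n" by (simp add: space_PiM space_restrict_space cube_def)
  note measurable_cube_component[measurable]
  have "{v \<in> space ?N. \<forall>k\<in>{1..n}. v k \<le> u k} \<in> sets ?N"
    by measurable
  then show "measure (distr M ?N X) {v \<in> cube n. \<forall>k\<in>{1..n}. v k \<le> u k} = C u"
    using range unfolding space C[OF u]
    by (subst measure_distr[OF X]) (auto intro!: arg_cong[where f="measure _"])
qed simp

section \<open>The order transform of the product copula\<close>

text \<open>The function \<open>G_k\<close> of the proof idea, taken with an extended argument to
  agree with \<open>univ_margin\<close>.\<close>

definition order_margin :: "nat \<Rightarrow> nat \<Rightarrow> ereal \<Rightarrow> real" where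
  "order_margin d k t = measure (unif d) {v \<in> space (unif d). ereal (order_map d v k) \<le> t}"

definition order_score :: "nat \<Rightarrow> (nat \<Rightarrow> real) \<Rightarrow> nat \<Rightarrow> real" where
  "order_score d v = (\<lambda>k\<in>{1..d}. order_margin d k (ereal (order_map d v k)))"

text \<open>The explicit candidate for the order transform, later confirmed by
  \<open>order_transform_product\<close>.\<close>

definition order_copula :: "nat \<Rightarrow> (nat \<Rightarrow> real) \<Rightarrow> real" where
  "order_copula d =
     (\<lambda>u\<in>cube d. measure (unif d) {v \<in> space (unif d). \<forall>k\<in>{1..d}. order_score d v k \<le> u k})"

lemma univ_margin_product:
  assumes "k \<in> {1..d}"
  shows "univ_margin d (copula_ext_T d (product_copula d)) k t = order_margin d k t"
proof -
  have "eta {k} (const_vec d \<infinity>) (const_vec d t) \<in> {1..d} \<rightarrow>\<^sub>E UNIV"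
    using assms by (auto simp: override_on_def const_vec_def PiE_iff extensional_def)
  then have "univ_margin d (copula_ext_T d (product_copula d)) k t
      = measure (unif d) {v \<in> space (unif d).
          \<forall>l\<in>{1..d}. ereal (order_map d v l) \<le> eta {k} (const_vec d \<infinity>) (const_vec d t) l}"
    unfolding univ_margin_def by (rule copula_ext_T_product)
  also have "\<dots> = order_margin d k t"
    unfolding order_margin_def using assms
    by (intro arg_cong[where f="measure _"] Collect_cong conj_cong refl)
      (auto simp: override_on_def const_vec_def)
  finally show ?thesis .
qed

lemma order_margin_bounds: "0 \<le> order_margin d k t" "order_margin d k t \<le> 1"
proof -
  interpret prob_space "unif d" by (rule prob_space_unif)
  show "0 \<le> order_margin d k t" "order_margin d k t \<le> 1"
    by (simp_all add: order_margin_def)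
qed

lemma order_margin_mono:
  assumes "k \<in> {1..d}" "s \<le> t"
  shows "order_margin d k s \<le> order_margin d k t"
proof -
  interpret prob_space "unif d" by (rule prob_space_unif)
  have [measurable]: "(\<lambda>v. order_map d v k) \<in> borel_measurable (unif d)"
    using assms(1) by measurable
  show ?thesis
    unfolding order_margin_def using assms(2)
    by (intro finite_measure_mono) (auto intro: order_trans)
qed

lemma order_map_bounds:
  assumes "v \<in> space (unif d)" "k \<in> {1..d}"
  shows "order_map d v k \<in> {0..1}"
  using cubeD[OF order_map_in_cube] assms by (simp add: space_unif)

lemma order_margin_eq_1:
  assumes "k \<in> {1..d}"
  shows "order_margin d k 1 = 1"
proof -
  interpret prob_space "unif d" by (rule prob_space_unif)
  have "{v \<in> space (unif d). ereal (order_map d v k) \<le> 1} = space (unif d)"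
    using order_map_bounds assms by (auto simp: one_ereal_def)
  then show ?thesis unfolding order_margin_def by (simp only: prob_space)
qed

text \<open>Surjectivity onto the unit interval is what makes the order transform unique: every
  point of the cube is a vector of marginal values.\<close>

lemma order_margin_attains:
  assumes "k \<in> {1..d}" "s \<in> {0..1}"
  shows "\<exists>t. order_margin d k t = s"
proof -
  obtain t where "measure (unif d) {v \<in> space (unif d). order_map d v k \<le> t} = s"
    using distribution_function_attains[OF prob_space_unif measurable_order_map_unif
        order_map_bounds AE_unif_order_map_neq assms(2)] assms(1) by blast
  then have "order_margin d k (ereal t) = s" by (simp add: order_margin_def)
  then show ?thesis ..
qed

lemma order_score_in_cube: "order_score d v \<in> cube d"
  by (auto simp: order_score_def cube_def order_margin_bounds)

lemma measurable_order_score [measurable]: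
  assumes "k \<in> {1..d}"
  shows "(\<lambda>v. order_score d v k) \<in> borel_measurable (unif d)"
proof -
  have "(\<lambda>t. order_margin d k (ereal t)) \<in> borel_measurable borel"
    using order_margin_mono[OF assms] by (intro borel_measurable_mono) (simp add: mono_def)
  then have "(\<lambda>v. order_margin d k (ereal (order_map d v k))) \<in> borel_measurable (unif d)"
    by (rule measurable_compose[OF measurable_order_map_unif[OF assms]])
  then show ?thesis using assms by (simp add: order_score_def)
qed

lemma order_score_uniform:
  assumes "k \<in> {1..d}" "s \<in> {0..1}"
  shows "measure (unif d) {v \<in> space (unif d). order_score d v k \<le> s} = s"
  using probability_integral_transform[OF prob_space_unif measurable_order_map_unif
      order_map_bounds AE_unif_order_map_neq assms(2)] assms(1)
  by (simp add: order_score_def order_margin_def)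

text \<open>The events \<open>X \<le> t\<close> and \<open>G X \<le> G t\<close> are nested and have the same probability \<open>G t\<close>.\<close>

lemma AE_order_score_le_iff:
  assumes k: "k \<in> {1..d}"
  shows "AE v in unif d. order_score d v k \<le> order_margin d k t \<longleftrightarrow> ereal (order_map d v k) \<le> t"
proof -
  interpret prob_space "unif d" by (rule prob_space_unif)
  have [measurable]: "(\<lambda>v. order_map d v k) \<in> borel_measurable (unif d)"
    "(\<lambda>v. order_score d v k) \<in> borel_measurable (unif d)"
    using k by measurable
  let ?A = "{v \<in> space (unif d). ereal (order_map d v k) \<le> t}"
  let ?B = "{v \<in> space (unif d). order_score d v k \<le> order_margin d k t}"
  have sub: "?A \<subseteq> ?B"
    using order_margin_mono[OF k] k by (auto simp: order_score_def)
  have "prob (?B - ?A) = prob ?B - prob ?A"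
    by (rule finite_measure_Diff) (use sub in auto)
  also have "\<dots> = 0"
    using order_score_uniform[OF k, of "order_margin d k t"]
    by (simp add: order_margin_bounds order_margin_def[symmetric])
  finally have "?B - ?A \<in> null_sets (unif d)"
    by (auto simp: null_sets_def emeasure_eq_measure)
  then show ?thesis
    by (rule AE_I') (use sub in auto)
qed

text \<open>The defining factorization of the order transform. For each of the finitely many
  coordinates the two inequalities agree almost surely, so the two lower-box events have equal
  probability.\<close>

lemma copula_ext_T_eq_order_copula:
  assumes x: "x \<in> {1..d} \<rightarrow>\<^sub>E UNIV"
  shows "copula_ext_T d (product_copula d) x
    = order_copula d (\<lambda>k\<in>{1..d}. order_margin d k (x k))"
proof -
  interpret prob_space "unif d" by (rule prob_space_unif)
  have "AE v in unif d. \<forall>k\<in>{1..d}. order_score d v k \<le> order_margin d k (x k)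
      \<longleftrightarrow> ereal (order_map d v k) \<le> x k"
    by (intro AE_finite_allI AE_order_score_le_iff) auto
  then have "AE v in unif d. (\<forall>k\<in>{1..d}. ereal (order_map d v k) \<le> x k)
      \<longleftrightarrow> (\<forall>k\<in>{1..d}. order_score d v k \<le> order_margin d k (x k))"
    by eventually_elim blast
  then have "measure (unif d) {v \<in> space (unif d). \<forall>k\<in>{1..d}. ereal (order_map d v k) \<le> x k}
    = measure (unif d) {v \<in> space (unif d). \<forall>k\<in>{1..d}. order_score d v k \<le> order_margin d k (x k)}"
    by (intro finite_measure_eq_AE) auto
  moreover have "(\<lambda>k\<in>{1..d}. order_margin d k (x k)) \<in> cube d"
    by (auto simp: cube_def order_margin_bounds)
  ultimately show ?thesis
    unfolding copula_ext_T_product[OF x] order_copula_def by simp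
qed

lemma order_transform_product: "order_transform d (product_copula d) = order_copula d"
  unfolding order_transform_def
proof (rule the_equality)
  let ?H = "copula_ext_T d (product_copula d)"
  let ?G = "\<lambda>x. \<lambda>k\<in>{1..d}. univ_margin d ?H k (x k)"
  have G: "?G x = (\<lambda>k\<in>{1..d}. order_margin d k (x k))" for x
    by (intro restrict_ext) (rule univ_margin_product)
  have "copula d (order_copula d)"
    unfolding order_copula_def
    by (intro copula_distribution_function prob_space_unif measurable_order_score
        order_score_in_cube order_score_uniform)
  then show "copula d (order_copula d) \<and> (\<forall>x\<in>{1..d} \<rightarrow>\<^sub>E UNIV. ?H x = order_copula d (?G x))"
    unfolding G using copula_ext_T_eq_order_copula by blast
  fix D assume D: "copula d D \<and> (\<forall>x\<in>{1..d} \<rightarrow>\<^sub>E UNIV. ?H x = D (?G x))"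
  \<comment> \<open>Each \<open>u\<close> in the cube has the form \<open>?G x\<close>, where the
    factorization prescribes the value of \<open>D\<close>; outside the cube both functions are
    undefined by extensionality.\<close>
  show "D = order_copula d"
  proof (rule extensionalityI[of _ "cube d"])
    show "D \<in> extensional (cube d)" using D by (auto simp: copula_def PiE_iff)
    fix u assume u: "u \<in> cube d"
    have "\<forall>k\<in>{1..d}. \<exists>t. order_margin d k t = u k"
      using order_margin_attains cubeD[OF u] by simp
    then obtain x where x: "\<forall>k\<in>{1..d}. order_margin d k (x k) = u k" by metis
    have eq: "?G (restrict x {1..d}) = u"
      unfolding G using x u by (auto simp: cube_def PiE_iff extensional_def fun_eq_iff)
    have r: "restrict x {1..d} \<in> {1..d} \<rightarrow>\<^sub>E UNIV" by auto
    show "D u = order_copula d u"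
      using D r copula_ext_T_eq_order_copula[OF r] eq unfolding G by metis
  qed (simp add: order_copula_def)
qed

lemma measurable_order_copula:
  assumes "\<And>k. k \<in> {1..d} \<Longrightarrow> (\<lambda>w. f w k) \<in> borel_measurable N"
    and "\<And>w. w \<in> space N \<Longrightarrow> f w \<in> cube d"
  shows "(\<lambda>w. order_copula d (f w)) \<in> borel_measurable N"
proof -
  have "(\<lambda>w. measure (unif d) {v \<in> space (unif d). \<forall>k\<in>{1..d}. order_score d v k \<le> f w k})
      \<in> borel_measurable N"
    by (rule borel_measurable_lower_box[OF prob_space_unif finite_atLeastAtMost
          measurable_order_score assms(1)])
  then show ?thesis
    by (rule measurable_cong[THEN iffD1, rotated]) (simp add: order_copula_def assms(2))
qed

lemma measurable_copula_ext_T_product: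
  assumes "\<And>k. k \<in> {1..d} \<Longrightarrow> (\<lambda>w. f w k) \<in> borel_measurable N"
    and "\<And>w. w \<in> space N \<Longrightarrow> f w \<in> {1..d} \<rightarrow>\<^sub>E UNIV"
  shows "(\<lambda>w. copula_ext_T d (product_copula d) (f w)) \<in> borel_measurable N"
proof -
  have "(\<lambda>w. measure (unif d) {v \<in> space (unif d). \<forall>k\<in>{1..d}. ereal (order_map d v k) \<le> f w k})
      \<in> borel_measurable N"
    by (rule borel_measurable_lower_box[OF prob_space_unif finite_atLeastAtMost _ assms(1)])
      (rule borel_measurable_ereal[OF measurable_order_map_unif])
  then show ?thesis
    by (rule measurable_cong[THEN iffD1, rotated]) (simp add: copula_ext_T_product assms(2))
qed

lemma copula_measure_order_copula:
  "copula_measure d (order_copula d)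
     = distr (unif d) (Pi\<^sub>M {1..d} (\<lambda>_. restrict_space borel {0..1})) (order_score d)"
  by (rule copula_measure_distr[OF prob_space_unif measurable_order_score order_score_in_cube])
    (simp_all add: order_copula_def)

section \<open>Margins of the order copula\<close>

lemma bij_betw_rank:
  fixes K :: "nat set"
  assumes "finite K"
  shows "bij_betw (\<lambda>k. card {l \<in> K. l \<le> k}) K {1..card K}"
proof -
  let ?r = "\<lambda>k. card {l \<in> K. l \<le> k}"
  have less: "?r i < ?r j" if "i < j" "j \<in> K" for i j
  proof (rule psubset_card_mono)
    have "j \<in> {l \<in> K. l \<le> j} - {l \<in> K. l \<le> i}" using that by simp
    moreover have "{l \<in> K. l \<le> i} \<subseteq> {l \<in> K. l \<le> j}" using that by auto
    ultimately show "{l \<in> K. l \<le> i} \<subset> {l \<in> K. l \<le> j}" by blast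
  qed (use assms in simp)
  have "inj_on ?r K"
  proof (rule inj_onI)
    fix i j assume "i \<in> K" "j \<in> K" "?r i = ?r j"
    then show "i = j" using less[of i j] less[of j i] by (metis linorder_neqE_nat less_irrefl)
  qed
  moreover have "?r ` K \<subseteq> {1..card K}"
  proof
    fix n assume "n \<in> ?r ` K"
    then obtain k where k: "k \<in> K" "n = ?r k" by auto
    have "{l \<in> K. l \<le> k} \<noteq> {}" using k by auto
    then have "1 \<le> n" using assms by (simp add: k(2) Suc_le_eq card_gt_0_iff One_nat_def)
    moreover have "n \<le> card K" unfolding k(2) using assms by (intro card_mono) auto
    ultimately show "n \<in> {1..card K}" by simp
  qed
  ultimately show ?thesis
    by (simp add: bij_betw_def card_image card_subset_eq)
qed

text \<open>The margin is the distribution function of the scores with index in \<open>K\<close>, so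
  its copula measure is the law of that subvector. Embedding the subvector back into the cube fills
  the other coordinates with 1, which is exactly \<open>eta K (const_vec d 1)\<close> applied to the
  full score vector.\<close>

lemma copula_pairing_margin_order_copula:
  assumes K: "K \<subseteq> {1..d}"
  shows "copula_pairing (card K) (margin d K (order_copula d)) (margin d K (order_copula d))
    = (\<integral>v. order_copula d (eta K (const_vec d 1) (order_score d v)) \<partial>unif d)"
proof -
  let ?m = "card K"
  let ?r = "\<lambda>k. card {l \<in> K. l \<le> k}"
  let ?N = "Pi\<^sub>M {1..?m} (\<lambda>_. restrict_space borel {0..1::real})"
  have fin: "finite K" using K by (rule finite_subset) simp
  have bij: "bij_betw ?r K {1..?m}" by (rule bij_betw_rank[OF fin])
  \<comment> \<open>The increasing enumeration of \<open>K\<close>, as inverse of the rank used by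
    \<open>margin_embed\<close>; \<open>Y\<close> below is the score vector read along it.\<close>
  define e where "e = the_inv_into K ?r"
  have r: "?r k \<in> {1..?m}" if "k \<in> K" for k
    using bij_betw_apply[OF bij that] .
  have er: "e (?r k) = k" if "k \<in> K" for k
    unfolding e_def by (rule the_inv_into_f_f[OF bij_betw_imp_inj_on[OF bij] that])
  have e: "e j \<in> K" if "j \<in> {1..?m}" for j
    unfolding e_def by (rule bij_betw_apply[OF bij_betw_the_inv_into[OF bij] that])
  have ed: "e j \<in> {1..d}" if "j \<in> {1..?m}" for j
    using e[OF that] K by blast
  have re: "?r (e j) = j" if "j \<in> {1..?m}" for j
    unfolding e_def by (rule f_the_inv_into_f_bij_betw[OF bij that])
  define Y where "Y v = (\<lambda>j\<in>{1..?m}. order_score d v (e j))" for v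
  have Y_cube: "Y v \<in> cube ?m" for v
    unfolding Y_def cube_def restrict_PiE_iff using cubeD[OF order_score_in_cube ed] by simp
  have Y_meas: "(\<lambda>v. Y v j) \<in> borel_measurable (unif d)" if "j \<in> {1..?m}" for j
    using measurable_order_score[OF ed[OF that]] that by (simp add: Y_def)
  have embed_cube: "margin_embed d K u \<in> cube d" if "u \<in> cube ?m" for u
    using cubeD[OF that r] by (auto simp: margin_embed_def cube_def)
  have margin: "margin d K (order_copula d) u
      = measure (unif d) {v \<in> space (unif d). \<forall>j\<in>{1..?m}. Y v j \<le> u j}" if u: "u \<in> cube ?m" for u
  proof -
    have "(\<forall>k\<in>{1..d}. order_score d v k \<le> margin_embed d K u k) \<longleftrightarrow> (\<forall>j\<in>{1..?m}. Y v j \<le> u j)" for v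
    proof safe
      fix j assume *: "\<forall>k\<in>{1..d}. order_score d v k \<le> margin_embed d K u k" and j: "j \<in> {1..?m}"
      from ed[OF j] * have "order_score d v (e j) \<le> margin_embed d K u (e j)" by blast
      then show "Y v j \<le> u j"
        using e[OF j] re[OF j] j ed[OF j] by (simp add: Y_def margin_embed_def)
    next
      fix k assume *: "\<forall>j\<in>{1..?m}. Y v j \<le> u j" and k: "k \<in> {1..d}"
      show "order_score d v k \<le> margin_embed d K u k"
      proof (cases "k \<in> K")
        case True
        have "Y v (?r k) \<le> u (?r k)" using * r[OF True] er[OF True] by blast
        then show ?thesis
          using True k r[OF True] er[OF True] by (simp add: Y_def margin_embed_def)
      next
        \<comment> \<open>Outside \<open>K\<close> the embedded corner is 1, and scores never exceed
          1.\<close>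
        case False
        then show ?thesis using cubeD[OF order_score_in_cube k] k by (simp add: margin_embed_def)
      qed
    qed
    then show ?thesis
      using u embed_cube[OF u] by (simp add: margin_def order_copula_def)
  qed
  have Y: "Y \<in> measurable (unif d) ?N"
    by (rule measurable_cubeI[OF Y_meas Y_cube])
  have "(\<lambda>u. measure (unif d) {v \<in> space (unif d). \<forall>j\<in>{1..?m}. Y v j \<le> u j}) \<in> borel_measurable ?N"
    by (rule borel_measurable_lower_box[OF prob_space_unif finite_atLeastAtMost Y_meas measurable_cube_component])
  then have meas: "margin d K (order_copula d) \<in> borel_measurable ?N"
    by (rule measurable_cong[THEN iffD1, rotated])
      (simp add: margin space_PiM space_restrict_space cube_def[symmetric])
  have embed: "margin_embed d K (Y v) = eta K (const_vec d 1) (order_score d v)" for v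
  proof
    fix k
    show "margin_embed d K (Y v) k = eta K (const_vec d 1) (order_score d v) k"
    proof (cases "k \<in> K")
      case True
      then have "k \<in> {1..d}" using K by blast
      then show ?thesis using True r[OF True] er[OF True] by (simp add: margin_embed_def Y_def)
    qed (simp add: margin_embed_def const_vec_def)
  qed
  have "copula_measure ?m (margin d K (order_copula d)) = distr (unif d) ?N Y"
    by (rule copula_measure_distr[OF prob_space_unif Y_meas Y_cube margin])
  then have "copula_pairing ?m (margin d K (order_copula d)) (margin d K (order_copula d))
      = (\<integral>v. margin d K (order_copula d) (Y v) \<partial>unif d)"
    unfolding copula_pairing_def using integral_distr[OF Y meas] by simp
  then show ?thesis by (simp only: margin_def restrict_apply Y_cube if_True embed)
qed

theorem theorem6p3:
  fixes d :: nat and K :: "nat set"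
  assumes "d \<ge> 2"
    and "K \<subseteq> {1..d}"
    and "card K \<ge> 2"
  shows "let C = order_transform d (product_copula d);
             H = copula_ext_T d (product_copula d)
         in copula_pairing (card K) (margin d K C) (margin d K C)
              = (\<integral>u. C (eta K (const_vec d 1) u) \<partial>copula_measure d C) \<and>
            (\<integral>u. C (eta K (const_vec d 1) u) \<partial>copula_measure d C)
              = (\<integral>x. H (eta K (const_vec d 1) x) \<partial>dist_measure d H) \<and>
            (\<integral>x. H (eta K (const_vec d 1) x) \<partial>dist_measure d H)
              = fact d * (LINT u : order_map d ` cube d | copula_measure d (product_copula d).
                  H (eta K (const_vec d 1) (ereal_vec d u)))"
proof -
  let ?H = "copula_ext_T d (product_copula d)"
  let ?N = "Pi\<^sub>M {1..d} (\<lambda>_. restrict_space borel {0..1::real})"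
  let ?T = "\<lambda>v. ereal_vec d (order_map d v)"
  interpret prob_space "unif d" by (rule prob_space_unif)
  have K: "k \<in> {1..d}" if "k \<in> K" for k using assms(2) that by blast
  have eta_cube: "eta K (const_vec d 1) u \<in> cube d" if "u \<in> cube d" for u
    using that K by (auto simp: cube_def PiE_iff override_on_def const_vec_def extensional_def)
  have eta_ext: "eta K (const_vec d 1) x \<in> {1..d} \<rightarrow>\<^sub>E UNIV" for x :: "nat \<Rightarrow> ereal"
    using K by (auto simp: PiE_iff override_on_def const_vec_def extensional_def)
  have space_N: "space ?N = cube d" by (simp add: space_PiM space_restrict_space cube_def)
  \<comment> \<open>Each coordinate is either a coordinate of \<open>f\<close> or the constant 1.
    The value type is left open to serve both real and extended vectors.\<close>
  have eta_meas: "(\<lambda>w. eta K (const_vec d 1) (f w) k) \<in> borel_measurable M"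
    if "\<And>k. k \<in> {1..d} \<Longrightarrow> (\<lambda>w. f w k) \<in> borel_measurable M" "k \<in> {1..d}"
    for M :: "'m measure" and f :: "'m \<Rightarrow> nat \<Rightarrow> 'c::{topological_space,one}" and k
    using that by (cases "k \<in> K") simp_all
  have score: "order_score d \<in> measurable (unif d) ?N"
    by (rule measurable_cubeI[OF measurable_order_score order_score_in_cube])
  have "(\<lambda>u. order_copula d (eta K (const_vec d 1) u)) \<in> borel_measurable ?N"
    by (rule measurable_order_copula[OF eta_meas[OF measurable_cube_component] eta_cube]) (simp_all add: space_N)
  then have C: "(\<integral>u. order_copula d (eta K (const_vec d 1) u) \<partial>copula_measure d (order_copula d))
      = (\<integral>v. order_copula d (eta K (const_vec d 1) (order_score d v)) \<partial>unif d)"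
    unfolding copula_measure_order_copula by (rule integral_distr[OF score])
  have "(\<lambda>x. ?H (eta K (const_vec d 1) x)) \<in> borel_measurable (ext_space d)"
    by (rule measurable_copula_ext_T_product[OF eta_meas eta_ext]) simp_all
  then have H: "(\<integral>x. ?H (eta K (const_vec d 1) x) \<partial>dist_measure d ?H)
      = (\<integral>v. ?H (eta K (const_vec d 1) (?T v)) \<partial>unif d)"
    unfolding dist_measure_copula_ext_T_product
    by (intro integral_distr measurable_ereal_vec measurable_order_map_unif)
  \<comment> \<open>The marginal distribution functions send 1 to 1, so the coordinates replaced by
    1 correspond on both sides. The identity therefore holds for every \<open>v\<close>, not merely
    almost everywhere.\<close>
  have CH: "order_copula d (eta K (const_vec d 1) (order_score d v))
      = ?H (eta K (const_vec d 1) (?T v))" for v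
  proof -
    have "(\<lambda>k\<in>{1..d}. order_margin d k (eta K (const_vec d 1) (?T v) k))
        = eta K (const_vec d 1) (order_score d v)"
    proof
      fix k
      show "(\<lambda>k\<in>{1..d}. order_margin d k (eta K (const_vec d 1) (?T v) k)) k
          = eta K (const_vec d 1) (order_score d v) k"
        using K[of k]
        by (cases "k \<in> K"; cases "k \<in> {1..d}")
          (auto simp: const_vec_def ereal_vec_def order_score_def order_margin_eq_1)
    qed
    then show ?thesis using copula_ext_T_eq_order_copula[OF eta_ext] by simp
  qed
  \<comment> \<open>Symmetrization applied to the integrand as a function of the unsorted point
    \<open>u\<close>; it is bounded by 1, being a probability.\<close>
  have "(\<integral>v. ?H (eta K (const_vec d 1) (?T v)) \<partial>unif d)
      = fact d * (LINT u : order_map d ` cube d | unif d. ?H (eta K (const_vec d 1) (ereal_vec d u)))"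
  proof (rule unif_symmetrize[where B=1])
    show "(\<lambda>u. ?H (eta K (const_vec d 1) (ereal_vec d u))) \<in> borel_measurable (unif d)"
      by (rule measurable_copula_ext_T_product[OF eta_meas eta_ext]) (simp_all add: ereal_vec_def)
    show "\<bar>?H (eta K (const_vec d 1) (ereal_vec d u))\<bar> \<le> 1" for u
      unfolding copula_ext_T_product[OF eta_ext] by simp
  qed
  then show ?thesis
    unfolding Let_def order_transform_product copula_measure_product
    using copula_pairing_margin_order_copula[OF assms(2)] C H CH by simp
qed

end
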